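(* For any positive integer $N$ the set $$\Bigl\{n^3 : n\in\mathbb{N},\ N\le n < N+\Bigl(\frac{38}{3}N+\frac{1297}{36}\Bigr)^{1/2}+\frac{19}{6}\Bigr\}$$ is a Sidon set. Moreover, the strict inequality "$<$" cannot be replaced by "$\le$", that is, there exist infinitely many positive integers $N$ such that the set $$\Bigl\{n^3 : n\in\mathbb{N},\ N\le n \le N+\Bigl(\frac{38}{3}N+\frac{1297}{36}\Bigr)^{1/2}+\frac{19}{6}\Bigr\}$$ is not a Sidon set.
   Context: $\mathbb{N}$ denotes the positive integers. A set $\mathcal{A}$ of integers is called a Sidon set if the equation $a_1+a_2=a_3+a_4$ with $a_1,a_2,a_3,a_4\in\mathcal{A}$ has only trivial solutions, i.e. every solution satisfies $\{a_1,a_2\}=\{a_3,a_4\}$. *)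

theory Defs
  imports Complex_Main
begin

definition sidon_set :: "int set \<Rightarrow> bool" where
  "sidon_set A \<longleftrightarrow>
     (\<forall>a\<^sub>1\<in>A. \<forall>a\<^sub>2\<in>A. \<forall>a\<^sub>3\<in>A. \<forall>a\<^sub>4\<in>A.
        a\<^sub>1 + a\<^sub>2 = a\<^sub>3 + a\<^sub>4 \<longrightarrow> {a\<^sub>1, a\<^sub>2} = {a\<^sub>3, a\<^sub>4})"

end

theory Submission
  imports Defs
begin

text \<open>
  Take a nontrivial solution of \<open>a^3 + b^3 = c^3 + d^3\<close> in positive integers with
  \<open>a < c \<le> d < b\<close>, and put \<open>s = a + b\<close>, \<open>x = b - a\<close>, \<open>y = d - c\<close>.  Since \<open>n^3\<close> and \<open>n\<close>
  agree modulo 6 and cubing is convex, \<open>c + d = s + 6 t\<close> with \<open>t \<ge> 1\<close>.  In these coordinates the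
  equation becomes
    \<open>s x^2 = 6 t s^2 + 36 t^2 s + 72 t^3 + (s + 6 t) y^2\<close>,
  so \<open>m = x^2 - 6 t s - 36 t^2 - y^2\<close> is an integer with \<open>m s = 72 t^3 + 6 t y^2\<close>; hence
  \<open>m > 0\<close>, and \<open>m\<close> is even because \<open>x\<close>, \<open>y\<close> and \<open>s\<close> have the same parity.  If \<open>t \<ge> 2\<close>, then
  \<open>x^2 > 12 s + 144\<close>, far more than needed.  If \<open>t = 1\<close>, eliminating \<open>y\<close> gives
  \<open>3 x^2 = (18 + m / 2) s + 72 + 3 m\<close>, whose least value, at \<open>m = 2\<close>, is \<open>19 s + 78\<close>.
  Thus \<open>3 x^2 \<ge> 19 s + 78\<close> in every case (\<open>cube_collision_spread\<close>), and completing the square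
  turns this inequality into
    \<open>b \<ge> a + sqrt (38 / 3 * a + 1297 / 36) + 19 / 6\<close>,
  so that the given interval is too short to contain a nontrivial solution.

  Equality holds exactly when \<open>t = 1\<close> and \<open>m = 2\<close>, that is, when \<open>s = 3 y^2 + 36\<close> and
  \<open>x^2 = 19 y^2 + 254\<close>.  This equation of Pell type has the solution \<open>(27, 5)\<close> (giving
  \<open>42^3 + 69^3 = 56^3 + 61^3\<close>), and the unit \<open>170 + 39 sqrt 19\<close> produces infinitely many more
  (\<open>pell_solutions_unbounded\<close>), each of which is a collision at the closed endpoint.
\<close>

section \<open>A lower bound for the spread of a collision\<close>

lemma six_dvd_cube_minus_self: "6 dvd n ^ 3 - (n :: int)"
proof -
  have "n mod 6 = 0 \<or> n mod 6 = 1 \<or> n mod 6 = 2 \<or> n mod 6 = 3 \<or> n mod 6 = 4 \<or> n mod 6 = 5"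
    by presburger
  then have "n ^ 3 mod 6 = n mod 6"
    by (auto simp: power_mod [of n 6 3, symmetric])
  then show ?thesis
    by (simp add: mod_eq_dvd_iff)
qed

text \<open>
  The cubes rise by the same amount from \<open>a\<close> to \<open>c\<close> as from \<open>d\<close> to \<open>b\<close>, and cubing is steeper on
  the upper interval, so the step \<open>b - d\<close> has to be shorter than \<open>c - a\<close>.
\<close>
lemma inner_pair_sum_gt:
  fixes a b c d :: int
  assumes "0 < a" "a < c" "c \<le> d" "d < b" and eq: "a ^ 3 + b ^ 3 = c ^ 3 + d ^ 3"
  shows "a + b < c + d"
proof (rule ccontr)
  assume "\<not> a + b < c + d"
  then have le: "c - a \<le> b - d" by simp
  have quot: "c * c + c * a + a * a < b * b + b * d + d * d"
    using assms(1-4) by (intro add_strict_mono mult_strict_mono) auto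
  have "(c - a) * (c * c + c * a + a * a) < (c - a) * (b * b + b * d + d * d)"
    using quot assms(2) by simp
  also have "\<dots> \<le> (b - d) * (b * b + b * d + d * d)"
    using le assms(1-4) by (intro mult_right_mono) auto
  also have "\<dots> = (c - a) * (c * c + c * a + a * a)"
    using eq by (simp add: algebra_simps power3_eq_cube)
  finally show False by simp
qed

text \<open>
  The constants are the best possible: equality holds for infinitely many solutions.  The proof
  is the computation with \<open>t\<close> and \<open>m\<close> described at the beginning.
\<close>
lemma cube_collision_spread:
  fixes a b c d :: int
  assumes "0 < a" "a < c" "c \<le> d" "d < b" and eq: "a ^ 3 + b ^ 3 = c ^ 3 + d ^ 3"
  shows "19 * (a + b) + 78 \<le> 3 * (b - a)\<^sup>2"
proof -
  define s x y where "s = a + b" and "x = b - a" and "y = d - c"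
  have s_pos: "0 < s" using assms by (simp add: s_def)
  have "6 dvd (a ^ 3 - a) + (b ^ 3 - b) - (c ^ 3 - c) - (d ^ 3 - d)"
    by (intro dvd_add dvd_diff six_dvd_cube_minus_self)
  also have "(a ^ 3 - a) + (b ^ 3 - b) - (c ^ 3 - c) - (d ^ 3 - d) = c + d - s"
    using eq by (simp add: s_def)
  finally obtain t where "c + d - s = 6 * t" ..
  then have t: "c + d = s + 6 * t" by simp
  with inner_pair_sum_gt[OF assms] have t_pos: "1 \<le> t" by (simp add: s_def)
  define m where "m = x\<^sup>2 - 6 * t * s - 36 * t\<^sup>2 - y\<^sup>2"
  \<comment> \<open>Four times a sum of two cubes is \<open>s (s^2 + 3 x^2)\<close> in terms of sum and difference.\<close>
  have "s * (s\<^sup>2 + 3 * x\<^sup>2) = 4 * (a ^ 3 + b ^ 3)"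
    by (simp add: s_def x_def power2_eq_square power3_eq_cube algebra_simps)
  also have "\<dots> = (c + d) * ((c + d)\<^sup>2 + 3 * y\<^sup>2)"
    unfolding eq by (simp add: y_def power2_eq_square power3_eq_cube algebra_simps)
  finally have "s * (s\<^sup>2 + 3 * x\<^sup>2) = (s + 6 * t) * ((s + 6 * t)\<^sup>2 + 3 * y\<^sup>2)"
    by (simp add: t)
  then have ms: "m * s = 72 * t ^ 3 + 6 * t * y\<^sup>2"
    by (simp add: m_def power2_eq_square power3_eq_cube algebra_simps)
  have "0 < m * s"
    unfolding ms using t_pos by (intro add_pos_nonneg) auto
  then have "0 < m" using s_pos by (simp add: zero_less_mult_iff)
  moreover have "even m"
  proof -
    have "even x = even s" by (simp add: x_def s_def) blast
    moreover have "even y = even (c + d)" by (simp add: y_def) blast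
    ultimately show ?thesis by (simp add: m_def t)
  qed
  ultimately have m_ge: "2 \<le> m" by presburger
  have x2: "x\<^sup>2 = 6 * (t * s) + 36 * t\<^sup>2 + y\<^sup>2 + m" by (simp add: m_def)
  have "19 * s + 78 \<le> 3 * x\<^sup>2"
  proof (cases "t = 1")
    case True
    have "2 * s \<le> m * s" using m_ge s_pos by (intro mult_right_mono) auto
    moreover have "m * s = 72 + 6 * y\<^sup>2" using ms True by simp
    ultimately show ?thesis using x2 m_ge True by simp
  next
    case False
    with t_pos have "2 \<le> t" by simp
    then have "2 * s \<le> t * s" and "2\<^sup>2 \<le> t\<^sup>2"
      using s_pos by (intro mult_right_mono power_mono; simp)+
    moreover have "0 \<le> y\<^sup>2" by simp
    ultimately show ?thesis using x2 m_ge s_pos unfolding power2_eq_square[of 2] by linarith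
  qed
  then show ?thesis by (simp add: s_def x_def)
qed

section \<open>Short intervals contain no collision\<close>

text \<open>
  Completing the square in \<open>cube_collision_spread\<close>, where \<open>a + b = 2 a + (b - a)\<close>, bounds \<open>b\<close> from
  below by an increasing function of \<open>a\<close>, so the left end of the interval may be moved down
  from \<open>a\<close> to \<open>N\<close>.
\<close>
lemma cube_collision_exceeds_interval:
  fixes a b c d :: int
  assumes "0 < a" "a < c" "c \<le> d" "d < b" "a ^ 3 + b ^ 3 = c ^ 3 + d ^ 3"
    and N: "int N \<le> a"
  shows "real N + sqrt (38 / 3 * real N + 1297 / 36) + 19 / 6 \<le> real_of_int b"
proof -
  define x where "x = b - a"
  have spread: "38 * a + 19 * x + 78 \<le> 3 * x\<^sup>2"
    using cube_collision_spread[OF assms(1-5)] by (simp add: x_def)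
  have x_pos: "0 < x" using assms by (simp add: x_def)
  \<comment> \<open>The bound forces \<open>x > 19 / 3\<close>, so \<open>x - 19 / 6\<close> is the nonnegative square root.\<close>
  have "19 * x < (3 * x) * x"
    using spread assms(1) by (simp add: power2_eq_square)
  then have "19 < 3 * x" using x_pos by (simp add: mult_less_cancel_right)
  have N': "real N \<le> real_of_int a" using N by linarith
  have "38 * real_of_int a + 19 * real_of_int x + 78 \<le> 3 * (real_of_int x)\<^sup>2"
    using spread by (metis (mono_tags) of_int_add of_int_le_iff of_int_mult of_int_numeral of_int_power)
  then have "38 / 3 * real N + 1297 / 36 \<le> (real_of_int x - 19 / 6)\<^sup>2"
    using N' by (simp add: power2_diff power_divide)
  then have "sqrt (38 / 3 * real N + 1297 / 36) \<le> real_of_int x - 19 / 6"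
    using \<open>19 < 3 * x\<close> by (intro real_le_lsqrt) auto
  then show ?thesis using N' by (simp add: x_def)
qed

text \<open>
  This reduces an arbitrary solution to the nested configuration \<open>a < c \<le> d < b\<close>: since cubing is
  strictly increasing, raising the smaller entry has to lower the larger one.
\<close>
lemma equal_cube_sums_cases:
  fixes p q r s :: int
  assumes "0 \<le> p" "0 \<le> r" "p \<le> q" "r \<le> s" and eq: "p ^ 3 + q ^ 3 = r ^ 3 + s ^ 3"
  obtains "p = r" "q = s" | "p < r" "s < q" | "r < p" "q < s"
proof -
  have cube_less: "u ^ 3 < v ^ 3 \<longleftrightarrow> u < v" if "0 \<le> u" "0 \<le> v" for u v :: int
    using that by (metis linorder_not_less power_mono_iff zero_less_numeral)
  have nonneg: "0 \<le> q" "0 \<le> s" using assms by simp_all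
  consider "p = r" | "p < r" | "r < p" by linarith
  then show ?thesis
  proof cases
    case 1
    with eq have "\<not> q ^ 3 < s ^ 3" "\<not> s ^ 3 < q ^ 3" by auto
    with 1 show ?thesis using that(1) by (simp add: cube_less assms nonneg)
  next
    case 2
    then have "p ^ 3 < r ^ 3" by (simp add: cube_less assms nonneg)
    with eq have "s ^ 3 < q ^ 3" by linarith
    with 2 show ?thesis using that(2) by (simp add: cube_less assms nonneg)
  next
    case 3
    then have "r ^ 3 < p ^ 3" by (simp add: cube_less assms nonneg)
    with eq have "q ^ 3 < s ^ 3" by linarith
    with 3 show ?thesis using that(3) by (simp add: cube_less assms nonneg)
  qed
qed

lemma sidon_cubes_of_short_interval:
  assumes "N > 0"
  shows "sidon_set {int n ^ 3 | n :: nat. n > 0 \<and> N \<le> n \<and>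
           real n < real N + sqrt (38 / 3 * real N + 1297 / 36) + 19 / 6}"
proof -
  define I where "I = {k :: int. 0 < k \<and> int N \<le> k \<and>
    real_of_int k < real N + sqrt (38 / 3 * real N + 1297 / 36) + 19 / 6}"
  have ordered: "p = r \<and> q = s"
    if mem: "p \<in> I" "q \<in> I" "r \<in> I" "s \<in> I" and "p \<le> q" "r \<le> s"
      and eq: "p ^ 3 + q ^ 3 = r ^ 3 + s ^ 3" for p q r s
  proof -
    have "0 \<le> p" "0 \<le> r" using mem by (simp_all add: I_def)
    then show ?thesis using \<open>p \<le> q\<close> \<open>r \<le> s\<close> eq
    proof (cases rule: equal_cube_sums_cases)
      case 2
      with cube_collision_exceeds_interval[of p r s q N] that show ?thesis by (auto simp: I_def)
    next
      case 3
      with cube_collision_exceeds_interval[of r p q s N] that show ?thesis by (auto simp: I_def)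
    qed simp
  qed
  have any_order: "{p, q} = {r, s}"
    if mem: "p \<in> I" "q \<in> I" "r \<in> I" "s \<in> I" and eq: "p ^ 3 + q ^ 3 = r ^ 3 + s ^ 3" for p q r s
  proof -
    have "min p q = min r s \<and> max p q = max r s"
      using mem eq by (intro ordered) (auto simp: min_def max_def)
    then show ?thesis by (auto simp: min_def max_def split: if_splits)
  qed
  have cubes: "{int n ^ 3 | n :: nat. n > 0 \<and> N \<le> n \<and>
      real n < real N + sqrt (38 / 3 * real N + 1297 / 36) + 19 / 6} \<subseteq> (\<lambda>k. k ^ 3) ` I"
    by (auto simp: I_def)
  have "{u, v} = {w, z}"
    if "u \<in> (\<lambda>k. k ^ 3) ` I" "v \<in> (\<lambda>k. k ^ 3) ` I" "w \<in> (\<lambda>k. k ^ 3) ` I" "z \<in> (\<lambda>k. k ^ 3) ` I"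
      and "u + v = w + z" for u v w z
  proof -
    from that obtain p q r s where "p \<in> I" "q \<in> I" "r \<in> I" "s \<in> I"
      and cube: "u = p ^ 3" "v = q ^ 3" "w = r ^ 3" "z = s ^ 3" by blast
    with any_order[of p q r s] that have "{p, q} = {r, s}" by simp
    then have "(\<lambda>k. k ^ 3) ` {p, q} = (\<lambda>k. k ^ 3) ` {r, s}" by (rule arg_cong)
    then show ?thesis by (simp add: cube)
  qed
  then show ?thesis using cubes unfolding sidon_set_def by (meson subsetD)
qed

section \<open>Collisions at the endpoint\<close>

text \<open>
  Multiplication of \<open>x + y sqrt 19\<close> by the unit \<open>170 + 39 sqrt 19\<close> of norm 1, starting at
  \<open>27 + 5 sqrt 19\<close>, preserves the norm 254 and the oddness of both coordinates.
\<close>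
lemma pell_solutions_unbounded:
  "\<exists>x y :: int. odd x \<and> odd y \<and> 0 < x \<and> int k + 5 \<le> y \<and> x\<^sup>2 = 19 * y\<^sup>2 + 254"
proof (induction k)
  case 0
  show ?case by (intro exI[of _ 27] exI[of _ 5]) simp
next
  case (Suc k)
  then obtain x y :: int where "odd x" "odd y" "0 < x" "int k + 5 \<le> y"
    and pell: "x\<^sup>2 = 19 * y\<^sup>2 + 254" by blast
  then have "odd (170 * x + 741 * y)" "odd (39 * x + 170 * y)"
    "0 < 170 * x + 741 * y" "int (Suc k) + 5 \<le> 39 * x + 170 * y"
    by auto
  moreover have "(170 * x + 741 * y)\<^sup>2 = 19 * (39 * x + 170 * y)\<^sup>2 + 254"
    using pell by (simp add: power2_eq_square algebra_simps)
  ultimately show ?case by blast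
qed

text \<open>
  This inverts the change of variables \<open>s = a + b\<close>, \<open>x = b - a\<close>, \<open>y = d - c\<close> in the case of equality
  \<open>s = 3 y^2 + 36\<close>, \<open>c + d = s + 6\<close>; oddness makes \<open>a\<close>, \<open>b\<close>, \<open>c\<close>, \<open>d\<close> integers.
\<close>
lemma extremal_cube_collision:
  fixes x y :: int
  assumes "odd x" "odd y" "0 < x" "5 \<le> y" and pell: "x\<^sup>2 = 19 * y\<^sup>2 + 254"
  obtains a b c d :: int where "y \<le> a" "a < c" "c \<le> d" "d < b"
    "a ^ 3 + b ^ 3 = c ^ 3 + d ^ 3" "3 * (b - a)\<^sup>2 = 19 * (a + b) + 78"
proof -
  have "even (3 * y\<^sup>2 + 36 - x)" "even (3 * y\<^sup>2 + 42 - y)"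
    using assms by simp_all
  then obtain a c where a: "3 * y\<^sup>2 + 36 - x = 2 * a" and c: "3 * y\<^sup>2 + 42 - y = 2 * c"
    by (elim evenE)
  have y2: "5 * y \<le> y\<^sup>2" using assms by (simp add: power2_eq_square)
  have "25 \<le> y\<^sup>2" using y2 assms by simp
  then have "x\<^sup>2 \<le> (6 * y)\<^sup>2" "(y + 6)\<^sup>2 < x\<^sup>2"
    using pell y2 by (simp_all add: power_mult_distrib power2_sum)
  then have x_le: "x \<le> 6 * y" and x_gt: "y + 6 < x"
    using assms by (auto intro: power2_le_imp_le power2_less_imp_less)
  have x_eq: "x = 3 * y\<^sup>2 + 36 - 2 * a" using a by simp
  show ?thesis
  proof (rule that[of a c "c + y" "a + x"])
    show "y \<le> a" using a x_le y2 assms by linarith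
    show "a < c" "c \<le> c + y" "c + y < a + x" using a c x_gt assms by linarith+
    \<comment> \<open>Both sides are rewritten in sum and difference coordinates, where \<open>x\<close> enters only
      through the sum and \<open>x\<^sup>2\<close>, which the Pell equation eliminates.\<close>
    have "4 * (a ^ 3 + (a + x) ^ 3) = (2 * a + x) * ((2 * a + x)\<^sup>2 + 3 * x\<^sup>2)"
      by (simp add: power2_eq_square power3_eq_cube algebra_simps)
    also have "\<dots> = (3 * y\<^sup>2 + 36) * ((3 * y\<^sup>2 + 36)\<^sup>2 + 3 * (19 * y\<^sup>2 + 254))"
      using x_eq pell by simp
    also have "\<dots> = (3 * y\<^sup>2 + 42) * ((3 * y\<^sup>2 + 42)\<^sup>2 + 3 * y\<^sup>2)"
      by (simp add: power2_eq_square algebra_simps)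
    also have "\<dots> = (2 * c + y) * ((2 * c + y)\<^sup>2 + 3 * y\<^sup>2)"
      using c by (simp flip: c)
    also have "\<dots> = 4 * (c ^ 3 + (c + y) ^ 3)"
      by (simp add: power2_eq_square power3_eq_cube algebra_simps)
    finally show "a ^ 3 + (a + x) ^ 3 = c ^ 3 + (c + y) ^ 3" by simp
    have "a + (a + x) = 3 * y\<^sup>2 + 36" using x_eq by simp
    then show "3 * ((a + x) - a)\<^sup>2 = 19 * (a + (a + x)) + 78"
      using pell by simp
  qed
qed

lemma not_sidon_of_extremal_collision:
  fixes a b c d :: int
  assumes "0 < a" "a < c" "c \<le> d" "d < b" and eq: "a ^ 3 + b ^ 3 = c ^ 3 + d ^ 3"
    and extremal: "3 * (b - a)\<^sup>2 = 19 * (a + b) + 78"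
  shows "\<not> sidon_set {int n ^ 3 | n :: nat. n > 0 \<and> nat a \<le> n \<and>
           real n \<le> real (nat a) + sqrt (38 / 3 * real (nat a) + 1297 / 36) + 19 / 6}"
    (is "\<not> sidon_set ?A")
proof -
  define x where "x = b - a"
  have "3 * x\<^sup>2 = 38 * a + 19 * x + 78" using extremal by (simp add: x_def)
  then have "3 * (real_of_int x)\<^sup>2 = 38 * real_of_int a + 19 * real_of_int x + 78"
    by (metis (mono_tags) of_int_add of_int_mult of_int_numeral of_int_power)
  then have "(real_of_int x - 19 / 6)\<^sup>2 = 38 / 3 * real_of_int a + 1297 / 36"
    by (simp add: power2_diff power_divide)
  then have "real_of_int x - 19 / 6 \<le> sqrt (38 / 3 * real_of_int a + 1297 / 36)"
    by (intro real_le_rsqrt) simp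
  then have b_le: "real_of_int b \<le>
      real (nat a) + sqrt (38 / 3 * real (nat a) + 1297 / 36) + 19 / 6"
    using assms(1) by (simp add: x_def)
  have mem: "k ^ 3 \<in> ?A" if "a \<le> k" "k \<le> b" for k :: int
  proof -
    have "real_of_int k \<le> real_of_int b" using that by simp
    with b_le have "real (nat k) \<le>
        real (nat a) + sqrt (38 / 3 * real (nat a) + 1297 / 36) + 19 / 6"
      using that assms(1) by simp
    then show ?thesis using that assms(1)
      by (intro CollectI exI[of _ "nat k"]) (auto simp: nat_le_eq_zle)
  qed
  have "a ^ 3 < c ^ 3" "a ^ 3 < d ^ 3" using assms by (auto intro!: power_strict_mono)
  then have "a ^ 3 \<notin> {c ^ 3, d ^ 3}" by simp
  then have "{a ^ 3, b ^ 3} \<noteq> {c ^ 3, d ^ 3}" by blast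
  moreover have "a ^ 3 \<in> ?A" "b ^ 3 \<in> ?A" "c ^ 3 \<in> ?A" "d ^ 3 \<in> ?A"
    using assms by (intro mem; simp)+
  ultimately show ?thesis using eq unfolding sidon_set_def by blast
qed

text \<open>
  Infinitely many left endpoints arise because the endpoint \<open>a\<close> of the collision built from \<open>(x, y)\<close> is at
  least \<open>y\<close>, and \<open>y\<close> is unbounded.
\<close>
theorem theorem3:
  shows "(\<forall>N::nat. N > 0 \<longrightarrow>
           sidon_set {int n ^ 3 | n :: nat. n > 0 \<and> N \<le> n \<and>
             real n < real N + sqrt (38 / 3 * real N + 1297 / 36) + 19 / 6})
       \<and> infinite {N::nat. N > 0 \<and>
           \<not> sidon_set {int n ^ 3 | n :: nat. n > 0 \<and> N \<le> n \<and>
             real n \<le> real N + sqrt (38 / 3 * real N + 1297 / 36) + 19 / 6}}"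
    (is "_ \<and> infinite ?S")
proof
  show "\<forall>N::nat. N > 0 \<longrightarrow>
           sidon_set {int n ^ 3 | n :: nat. n > 0 \<and> N \<le> n \<and>
             real n < real N + sqrt (38 / 3 * real N + 1297 / 36) + 19 / 6}"
    using sidon_cubes_of_short_interval by blast
  have "\<exists>N \<ge> k. N \<in> ?S" for k
  proof -
    obtain x y :: int where xy: "odd x" "odd y" "0 < x" "int k + 5 \<le> y" "x\<^sup>2 = 19 * y\<^sup>2 + 254"
      using pell_solutions_unbounded by blast
    then have "5 \<le> y" by simp
    obtain a b c d :: int where abcd: "y \<le> a" "a < c" "c \<le> d" "d < b"
      "a ^ 3 + b ^ 3 = c ^ 3 + d ^ 3" "3 * (b - a)\<^sup>2 = 19 * (a + b) + 78"
      by (rule extremal_cube_collision[OF xy(1-3) \<open>5 \<le> y\<close> xy(5)])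
    with \<open>5 \<le> y\<close> have "0 < a" by simp
    with abcd have "nat a \<in> ?S"
      using not_sidon_of_extremal_collision[of a c d b] by simp
    moreover have "k \<le> nat a" using abcd(1) xy(4) by simp
    ultimately show ?thesis by blast
  qed
  then show "infinite ?S"
    unfolding finite_nat_set_iff_bounded by (meson linorder_not_less)
qed

end
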